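(* Consider the three-state Markov chain with transition matrix $$P=\begin{bmatrix}0&1&0\\0&0&1\\\tfrac12&\tfrac12&0\end{bmatrix},$$ and let $\pi$ be its stationary distribution. Then $$\|p^k-\pi\|_{TV}\le O\Big(\big(\sqrt{\tfrac12}\,\big)^k\Big),$$ i.e. there is a constant $C<\infty$ such that $\|p^k-\pi\|_{TV}\le C\,2^{-k/2}$ for all integers $k\ge1$.
   Context: $\|p^k-\pi\|_{TV}=\max_{i}\|p^k(i,\cdot)-\pi\|_{TV}$ is the worst-case total variation distance, where $p^k(i,j)$ is the $(i,j)$ entry of $P^k$ and $\|p^k(i,\cdot)-\pi\|_{TV}=\tfrac12\sum_j|p^k(i,j)-\pi_j|$. *)

theory Defs
  imports "HOL-Analysis.Analysis" "HOL-Library.Landau_Symbols"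
begin

(* On square matrices of type real ^ 'n ^ 'n the library's (^) is the entrywise power,
   so the power with respect to the matrix product is introduced separately. *)
primrec matrix_power :: "real ^ 'n ^ 'n \<Rightarrow> nat \<Rightarrow> real ^ 'n ^ 'n" where
  "matrix_power A 0 = mat 1"
| "matrix_power A (Suc k) = A ** matrix_power A k"

definition probability_vector :: "real ^ 'n \<Rightarrow> bool" where
  "probability_vector \<mu> \<longleftrightarrow> (\<forall>i. 0 \<le> \<mu> $ i) \<and> (\<Sum>i\<in>UNIV. \<mu> $ i) = 1"

definition stationary_distribution :: "real ^ 'n ^ 'n \<Rightarrow> real ^ 'n \<Rightarrow> bool" where
  "stationary_distribution P \<pi> \<longleftrightarrow> probability_vector \<pi> \<and> \<pi> v* P = \<pi>"

definition tv_dist :: "real ^ 'n \<Rightarrow> real ^ 'n \<Rightarrow> real" where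
  "tv_dist \<mu> \<nu> = 1 / 2 * (\<Sum>j\<in>UNIV. \<bar>\<mu> $ j - \<nu> $ j\<bar>)"

definition worst_tv_dist :: "real ^ 'n ^ 'n \<Rightarrow> real ^ 'n \<Rightarrow> nat \<Rightarrow> real" where
  "worst_tv_dist P \<pi> k = (MAX i. tv_dist (row i (matrix_power P k)) \<pi>)"

definition chain_P :: "real ^ 3 ^ 3" where
  "chain_P = vector [vector [0, 1, 0],
                     vector [0, 0, 1],
                     vector [1/2, 1/2, 0]]"

lemma chain_P_stochastic: "probability_vector (row i chain_P)"
proof -
  have "\<forall>i. probability_vector (row i chain_P)"
    by (simp add: probability_vector_def row_def chain_P_def forall_3 sum_3)
  then show ?thesis ..
qed

lemma chain_P_stationary_distribution_iff:
  "stationary_distribution chain_P \<pi> \<longleftrightarrow> \<pi> = vector [1/5, 2/5, 2/5]"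
  by (auto simp: stationary_distribution_def probability_vector_def chain_P_def
      vector_matrix_mult_def vec_eq_iff forall_3 sum_3)

lemma chain_P_stationary_distribution_unique: "\<exists>!\<pi>. stationary_distribution chain_P \<pi>"
  by (simp add: chain_P_stationary_distribution_iff)

end

(* Every column x of P^k satisfies x1 + 2 x2 + 2 x3 = 5 \<pi>_j. Hence the deviation d from \<pi>_j evolves
   by (u, v) \<mapsto> (v, - v - u/2) on its first two coordinates; this map has determinant 1/2
   and multiplies the positive definite quadratic form (u + v)^2 + v^2 by exactly 1/2.
   The square root of the form bounds d up to a constant factor. *)
theory Submission
  imports Defs
begin

text \<open>Multiplying by \<open>chain_P\<close> on the left acts on each column separately, so the
  column index \<open>j\<close> is only a parameter from here on.\<close>

lemma matrix_power_chain_P_Suc: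
  "matrix_power chain_P (Suc k) $ 1 $ j = matrix_power chain_P k $ 2 $ j"
  "matrix_power chain_P (Suc k) $ 2 $ j = matrix_power chain_P k $ 3 $ j"
  "matrix_power chain_P (Suc k) $ 3 $ j =
    (matrix_power chain_P k $ 1 $ j + matrix_power chain_P k $ 2 $ j) / 2"
  by (simp_all add: matrix_matrix_mult_def chain_P_def sum_3 add_divide_distrib)

text \<open>The weights 1, 2, 2 are 5 \<pi>, a left fixed vector of \<open>chain_P\<close>, so this
  combination of the entries of a column never changes; at time 0 it equals 5 \<pi>_j, which the
  subtraction cancels.\<close>

lemma deviation_recurrence:
  fixes \<pi> :: "real ^ 3"
  assumes "stationary_distribution chain_P \<pi>"
  defines "d \<equiv> \<lambda>k i j. matrix_power chain_P k $ i $ j - \<pi> $ j"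
  shows "d k 1 j + 2 * d k 2 j + 2 * d k 3 j = 0"
proof (induction k)
  case 0
  have "\<forall>j. d 0 1 j + 2 * d 0 2 j + 2 * d 0 3 j = 0"
    using assms(1)
    by (simp add: chain_P_stationary_distribution_iff d_def mat_def forall_3)
  then show ?case ..
next
  case (Suc k)
  then show ?case
    by (simp add: d_def matrix_power_chain_P_Suc field_simps del: matrix_power.simps)
qed

lemma deviation_form_eq:
  fixes \<pi> :: "real ^ 3"
  assumes "stationary_distribution chain_P \<pi>"
  defines "d \<equiv> \<lambda>k i j. matrix_power chain_P k $ i $ j - \<pi> $ j"
  shows "(d k 1 j + d k 2 j)\<^sup>2 + (d k 2 j)\<^sup>2 =
    ((d 0 1 j + d 0 2 j)\<^sup>2 + (d 0 2 j)\<^sup>2) * (1 / 2) ^ k"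
proof (induction k)
  case (Suc k)
  have "d k 1 j + 2 * d k 2 j + 2 * d k 3 j = 0"
    using deviation_recurrence[OF assms(1)] by (simp add: d_def)
  then have eq: "d k 3 j = - d k 2 j - d k 1 j / 2"
    by linarith
  have "(d (Suc k) 1 j + d (Suc k) 2 j)\<^sup>2 + (d (Suc k) 2 j)\<^sup>2 =
      (d k 2 j + d k 3 j)\<^sup>2 + (d k 3 j)\<^sup>2"
    by (simp add: d_def matrix_power_chain_P_Suc del: matrix_power.simps)
  \<comment> \<open>With u, v the first two deviations, \<open>eq\<close> turns the left side into
    (u/2)^2 + (v + u/2)^2 = u^2/2 + uv + v^2.\<close>
  also have "\<dots> = ((d k 1 j + d k 2 j)\<^sup>2 + (d k 2 j)\<^sup>2) / 2"
    unfolding eq by (simp add: power2_eq_square field_simps)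
  finally show ?case
    using Suc.IH by simp
qed simp

lemma deviation_le:
  fixes \<pi> :: "real ^ 3"
  assumes "stationary_distribution chain_P \<pi>"
  shows "\<bar>matrix_power chain_P k $ i $ j - \<pi> $ j\<bar> \<le> 2 * sqrt (1 / 2) ^ k"
proof -
  define d where "d = (\<lambda>k i j. matrix_power chain_P k $ i $ j - \<pi> $ j)"
  define r where "r = sqrt (1 / 2) ^ k"
  \<comment> \<open>The initial values of the form for j = 1, 2, 3 are 2/5, 2/5 and 4/5.\<close>
  have "\<forall>j. (d 0 1 j + d 0 2 j)\<^sup>2 + (d 0 2 j)\<^sup>2 \<le> 1"
    using assms
    by (simp add: chain_P_stationary_distribution_iff d_def mat_def forall_3 power2_eq_square)
  then have "(d k 1 j + d k 2 j)\<^sup>2 + (d k 2 j)\<^sup>2 \<le> (1 / 2) ^ k"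
    using deviation_form_eq[OF assms, of k j] by (simp add: d_def mult_left_le_one_le)
  also have "(1 / 2) ^ k = r\<^sup>2"
    by (simp add: r_def power_mult[symmetric] mult.commute[of k] power_mult)
  finally have Q: "(d k 1 j + d k 2 j)\<^sup>2 + (d k 2 j)\<^sup>2 \<le> r\<^sup>2" .
  have r: "r \<ge> 0" by (simp add: r_def)
  have "(d k 1 j + d k 2 j)\<^sup>2 \<le> r\<^sup>2" "(d k 2 j)\<^sup>2 \<le> r\<^sup>2"
    using Q by (smt (verit) zero_le_power2)+
  then have "\<bar>d k 1 j + d k 2 j\<bar> \<le> r" "\<bar>d k 2 j\<bar> \<le> r"
    using r abs_le_square_iff[of _ r] by simp_all
  moreover have "d k 1 j + 2 * d k 2 j + 2 * d k 3 j = 0"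
    using deviation_recurrence[OF assms] by (simp add: d_def)
  \<comment> \<open>The first deviation is (u + v) - v, hence the factor 2; the third is -((u + v) +
    v) / 2, so r alone bounds it.\<close>
  ultimately have "\<forall>i. \<bar>d k i j\<bar> \<le> 2 * r"
    unfolding forall_3 by linarith
  then show ?thesis
    by (simp add: d_def r_def)
qed

text \<open>The O-bound concerns absolute values, which this sign removes. The maximum dominates
  every row, so an arbitrary index such as \<open>undefined\<close> suffices.\<close>

lemma worst_tv_dist_nonneg: "0 \<le> worst_tv_dist P \<pi> k"
proof -
  have "0 \<le> tv_dist (row undefined (matrix_power P k)) \<pi>"
    by (simp add: tv_dist_def sum_nonneg)
  also have "\<dots> \<le> worst_tv_dist P \<pi> k"
    by (simp add: worst_tv_dist_def)
  finally show ?thesis .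
qed

lemma worst_tv_dist_chain_P_le:
  assumes "stationary_distribution chain_P \<pi>"
  shows "worst_tv_dist chain_P \<pi> k \<le> 3 * sqrt (1 / 2) ^ k"
proof -
  \<comment> \<open>The constant 3 is half the sum of three entries, each at most twice the
    power.\<close>
  have "tv_dist (row i (matrix_power chain_P k)) \<pi> \<le> 3 * sqrt (1 / 2) ^ k" for i
    using deviation_le[OF assms, of k i 1] deviation_le[OF assms, of k i 2]
      deviation_le[OF assms, of k i 3]
    by (simp add: tv_dist_def row_def sum_3)
  then show ?thesis
    by (simp add: worst_tv_dist_def)
qed

theorem mainTheorem11:
  fixes \<pi> :: "real ^ 3"
  assumes "stationary_distribution chain_P \<pi>"
  shows "(\<lambda>k. worst_tv_dist chain_P \<pi> k) \<in> O(\<lambda>k. sqrt (1 / 2) ^ k) \<and>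
    (\<exists>C::real. \<forall>k\<ge>1. worst_tv_dist chain_P \<pi> k \<le> C * 2 powr (- real k / 2))"
proof
  show "(\<lambda>k. worst_tv_dist chain_P \<pi> k) \<in> O(\<lambda>k. sqrt (1 / 2) ^ k)"
    using worst_tv_dist_chain_P_le[OF assms] worst_tv_dist_nonneg[of chain_P \<pi>]
    by (intro bigoI[of _ 3]) simp
  have "sqrt (1 / 2) ^ k = 2 powr (- real k / 2)" for k
  proof -
    have "sqrt (1 / 2) = 2 powr (- 1 / 2)"
      by (simp add: real_sqrt_divide powr_minus_divide powr_half_sqrt)
    moreover have "(2 powr (- 1 / 2)) ^ k = (2::real) powr (- real k / 2)"
      by (simp add: powr_power)
    ultimately show ?thesis
      by simp
  qed
  then show "\<exists>C. \<forall>k\<ge>1. worst_tv_dist chain_P \<pi> k \<le> C * 2 powr (- real k / 2)"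
    using worst_tv_dist_chain_P_le[OF assms] by auto
qed

end
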